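(* Let $N$ be a knot manifold with $H_1(N;\mathbb{Z})\cong\mathbb{Z}$, and let $\alpha$ be (the slope of) a peripheral element of $\pi_1(N)$ whose image generates $H_1(N;\mathbb{Z})$. Let $\mathsf{X}_A\subseteq\mathsf{X}(N)$ be the curve consisting of all characters of abelian representations of $\pi_1(N)$ (those factoring through $H_1(N;\mathbb{Z})$). Then $$\mathrm{Rk}_{\mathsf{X}_A}^{\mathbb{C}}(\alpha)=\mathrm{Rk}_{\mathsf{X}_A}^{\mathbb{Z}}(\alpha)=1.$$
   Context: A knot manifold is a connected, compact, irreducible, orientable 3-manifold whose boundary is an incompressible torus. $\mathsf{X}(N)$ is the affine algebraic set of characters $\chi_\rho=\mathrm{Tr}\circ\rho$ of representations $\rho\colon\pi_1(N)\to\mathrm{SL}_2(\mathbb{C})$. For an algebraic subset $\mathsf{X}\subseteq\mathsf{X}(N)$ and $\gamma\in\pi_1(N)$, $I_\gamma\in\mathbb{C}[\mathsf{X}]$ is $I_\gamma(\chi)=\chi(\gamma)$; the trace ring $T(\mathsf{X})$ is the subring (with 1) of $\mathbb{C}[\mathsf{X}]$ generated by all $I_\gamma$. For $\alpha$ a slope (unoriented isotopy class of an essential simple closed curve in $\partial N$), $I_\alpha:=I_\gamma$ for any peripheral element $\gamma$ representing $\alpha$. $\mathrm{Rk}_{\mathsf{X}}^{\mathbb{C}}(\alpha)$ is the rank of $\mathbb{C}[\mathsf{X}]$ as a $\mathbb{C}[I_\alpha]$-module and $\mathrm{Rk}_{\mathsf{X}}^{\mathbb{Z}}(\alpha)$ is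 the rank of $T(\mathsf{X})$ as a $\mathbb{Z}[I_\alpha]$-module, where rank means the minimal number of elements in a generating set ($\infty$ if not finitely generated). *)

theory Defs
  imports
    "HOL-Analysis.Analysis"
    "HOL-Homology.Homology"
    "HOL-Algebra.Generated_Rings"
    "HOL-Algebra.Module"
    "HOL-Library.Extended_Nat"
begin

section \<open>Paths, fundamental group and Hurewicz map\<close>

text \<open>The path operations of the library require a type of class \<open>topological_space\<close>; spaces are
  here values of type \<open>'a topology\<close>, so the operations are restated. As in the library, a path
  is a function on all reals of which only the values on \<open>{0..1}\<close> matter.\<close>

definition path_concat :: "(real \<Rightarrow> 'a) \<Rightarrow> (real \<Rightarrow> 'a) \<Rightarrow> real \<Rightarrow> 'a"
  where "path_concat p q = (\<lambda>t. if t \<le> 1/2 then p (2 * t) else q (2 * t - 1))"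

definition path_reverse :: "(real \<Rightarrow> 'a) \<Rightarrow> real \<Rightarrow> 'a"
  where "path_reverse p = (\<lambda>t. p (1 - t))"

definition path_homotopic :: "'a topology \<Rightarrow> (real \<Rightarrow> 'a) \<Rightarrow> (real \<Rightarrow> 'a) \<Rightarrow> bool"
  where "path_homotopic X p q \<longleftrightarrow>
    homotopic_with (\<lambda>r. r 0 = p 0 \<and> r 1 = p 1) (top_of_set {0..1}) X p q"

definition path_class :: "'a topology \<Rightarrow> (real \<Rightarrow> 'a) \<Rightarrow> (real \<Rightarrow> 'a) set"
  where "path_class X p = {q. path_homotopic X p q}"

definition fundamental_group :: "'a topology \<Rightarrow> 'a \<Rightarrow> (real \<Rightarrow> 'a) set monoid"
  where "fundamental_group X x0 =
    \<lparr>carrier = {path_class X p | p. pathin X p \<and> p 0 = x0 \<and> p 1 = x0},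
     monoid.mult = (\<lambda>g h. {r. \<exists>p\<in>g. \<exists>q\<in>h. path_homotopic X (path_concat p q) r}),
     one = path_class X (\<lambda>_. x0)\<rparr>"

text \<open>A path as a singular 1-simplex: the standard 1-simplex consists of the \<open>x\<close> with
  \<open>x 0 + x 1 = 1\<close> and is parametrised by \<open>x 1\<close>.\<close>

definition path_simplex :: "(real \<Rightarrow> 'a) \<Rightarrow> (nat \<Rightarrow> real) \<Rightarrow> 'a"
  where "path_simplex p = (\<lambda>x\<in>standard_simplex 1. p (x 1))"

text \<open>The homology class does not depend on the chosen representative of \<open>g\<close>.\<close>

definition hurewicz :: "'a topology \<Rightarrow> (real \<Rightarrow> 'a) set \<Rightarrow> 'a chain set"
  where "hurewicz X g = homologous_rel_set 1 X {} (frag_of (path_simplex (SOME p. p \<in> g)))"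


section \<open>Knot manifolds\<close>

definition half_space3 :: "(real^3) set"
  where "half_space3 = {v. 0 \<le> v $ 3}"

definition manifold3_with_boundary :: "'a topology \<Rightarrow> bool"
  where "manifold3_with_boundary N \<longleftrightarrow>
    Hausdorff_space N \<and> second_countable N \<and>
    (\<forall>x\<in>topspace N. \<exists>U V. openin N U \<and> x \<in> U \<and> openin (top_of_set half_space3) V \<and>
       subtopology N U homeomorphic_space top_of_set V)"

definition manifold_interior :: "'a topology \<Rightarrow> 'a set"
  where "manifold_interior N =
    {x. \<exists>U V. openin N U \<and> x \<in> U \<and> open (V :: (real^3) set) \<and>
       subtopology N U homeomorphic_space top_of_set V}"

definition manifold_boundary :: "'a topology \<Rightarrow> 'a set"
  where "manifold_boundary N = topspace N - manifold_interior N"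

abbreviation interior_space :: "'a topology \<Rightarrow> 'a topology"
  where "interior_space N \<equiv> subtopology N (manifold_interior N)"

abbreviation boundary_space :: "'a topology \<Rightarrow> 'a topology"
  where "boundary_space N \<equiv> subtopology N (manifold_boundary N)"

text \<open>Orientability of the interior \<open>M\<close>: a choice of generators \<open>\<mu> x\<close> of the local homology groups
  \<open>H\<^sub>3(M, M - {x})\<close> that is locally induced by classes in \<open>H\<^sub>3(M, M - U)\<close>.\<close>

definition orientable3 :: "'a topology \<Rightarrow> bool"
  where "orientable3 N \<longleftrightarrow>
    (let M = interior_space N in
     \<exists>\<mu>. \<forall>x\<in>topspace M.
       \<mu> x \<in> carrier (relative_homology_group 3 M (topspace M - {x})) \<and>
       generate (relative_homology_group 3 M (topspace M - {x})) {\<mu> x}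
         = carrier (relative_homology_group 3 M (topspace M - {x})) \<and>
       (\<exists>U. openin M U \<and> x \<in> U \<and>
         (\<exists>u\<in>carrier (relative_homology_group 3 M (topspace M - U)).
            \<forall>y\<in>U. hom_induced 3 M (topspace M - U) M (topspace M - {y}) id u = \<mu> y)))"

text \<open>Irreducibility: every 2-sphere in the interior bounds a 3-ball. To exclude wild spheres, the
  spheres considered are those with a bicollar \<open>e\<close>.\<close>

definition irreducible3 :: "'a topology \<Rightarrow> bool"
  where "irreducible3 N \<longleftrightarrow>
    (\<forall>e. embedding_map
           (prod_topology (top_of_set (sphere (0::real^3) 1)) (top_of_set {-1<..<1::real}))
           (interior_space N) e \<longrightarrow>
       (\<exists>b. embedding_map (top_of_set (cball (0::real^3) 1)) N b \<and>
            b ` sphere 0 1 = e ` (sphere 0 1 \<times> {0})))"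

definition boundary_is_torus :: "'a topology \<Rightarrow> bool"
  where "boundary_is_torus N \<longleftrightarrow>
    boundary_space N homeomorphic_space
      prod_topology (top_of_set (sphere (0::complex) 1)) (top_of_set (sphere (0::complex) 1))"

text \<open>Incompressibility of the boundary: the inclusion is injective on fundamental groups.\<close>

definition incompressible_boundary :: "'a topology \<Rightarrow> bool"
  where "incompressible_boundary N \<longleftrightarrow>
    (\<forall>p q. pathin (boundary_space N) p \<and> pathin (boundary_space N) q \<and>
       p 0 = p 1 \<and> q 0 = p 0 \<and> q 1 = p 0 \<and> path_homotopic N p q \<longrightarrow>
       path_homotopic (boundary_space N) p q)"

definition knot_manifold :: "'a topology \<Rightarrow> bool"
  where "knot_manifold N \<longleftrightarrow>
    manifold3_with_boundary N \<and> connected_space N \<and> compact_space N \<and> irreducible3 N \<and>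
    orientable3 N \<and> boundary_is_torus N \<and> incompressible_boundary N"


section \<open>Slopes\<close>

definition simple_closed_curve :: "'a topology \<Rightarrow> (real \<Rightarrow> 'a) \<Rightarrow> bool"
  where "simple_closed_curve B c \<longleftrightarrow> pathin B c \<and> c 0 = c 1 \<and> inj_on c {0..<1}"

definition essential_curve :: "'a topology \<Rightarrow> (real \<Rightarrow> 'a) \<Rightarrow> bool"
  where "essential_curve B c \<longleftrightarrow>
    (\<nexists>b. homotopic_with (\<lambda>r. r 0 = r 1) (top_of_set {0..1}) B c (\<lambda>_. b))"

definition isotopic_curves :: "'a topology \<Rightarrow> (real \<Rightarrow> 'a) \<Rightarrow> (real \<Rightarrow> 'a) \<Rightarrow> bool"
  where "isotopic_curves B c d \<longleftrightarrow>
    homotopic_with (\<lambda>r. r 0 = r 1 \<and> inj_on r {0..<1}) (top_of_set {0..1}) B c d"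

definition unoriented_isotopy_class :: "'a topology \<Rightarrow> (real \<Rightarrow> 'a) \<Rightarrow> (real \<Rightarrow> 'a) set"
  where "unoriented_isotopy_class B c =
    {d. isotopic_curves B c d \<or> isotopic_curves B c (path_reverse d)}"

definition slopes :: "'a topology \<Rightarrow> (real \<Rightarrow> 'a) set set"
  where "slopes N =
    {unoriented_isotopy_class (boundary_space N) c | c.
       simple_closed_curve (boundary_space N) c \<and> essential_curve (boundary_space N) c}"

text \<open>The elements of \<open>\<pi>\<^sub>1(N, x0)\<close> conjugate into \<open>\<pi>\<^sub>1(\<partial>N)\<close>, along a path \<open>t\<close> from the base point.\<close>

definition peripheral_elements :: "'a topology \<Rightarrow> 'a \<Rightarrow> (real \<Rightarrow> 'a) set set"
  where "peripheral_elements N x0 =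
    {path_class N (path_concat t (path_concat c (path_reverse t))) | c t.
       pathin (boundary_space N) c \<and> c 0 = c 1 \<and> pathin N t \<and> t 0 = x0 \<and> t 1 = c 0}"

definition represents_slope ::
    "'a topology \<Rightarrow> 'a \<Rightarrow> (real \<Rightarrow> 'a) set \<Rightarrow> (real \<Rightarrow> 'a) set \<Rightarrow> bool"
  where "represents_slope N x0 \<gamma> \<alpha> \<longleftrightarrow>
    (\<exists>c\<in>\<alpha>. \<exists>t. pathin N t \<and> t 0 = x0 \<and> t 1 = c 0 \<and>
       \<gamma> = path_class N (path_concat t (path_concat c (path_reverse t))))"


section \<open>Representations and characters\<close>

definition SL2C :: "(complex^2^2) monoid"
  where "SL2C = \<lparr>carrier = {A. det A = 1}, monoid.mult = (**), one = mat 1\<rparr>"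

type_synonym 'a character = "(real \<Rightarrow> 'a) set \<Rightarrow> complex"

definition character_of ::
    "'a topology \<Rightarrow> 'a \<Rightarrow> ((real \<Rightarrow> 'a) set \<Rightarrow> complex^2^2) \<Rightarrow> 'a character"
  where "character_of N x0 \<rho> = (\<lambda>g\<in>carrier (fundamental_group N x0). trace (\<rho> g))"

definition character_variety :: "'a topology \<Rightarrow> 'a \<Rightarrow> 'a character set"
  where "character_variety N x0 = character_of N x0 ` hom (fundamental_group N x0) SL2C"

definition abelian_representations ::
    "'a topology \<Rightarrow> 'a \<Rightarrow> ((real \<Rightarrow> 'a) set \<Rightarrow> complex^2^2) set"
  where "abelian_representations N x0 =
    {\<rho> \<in> hom (fundamental_group N x0) SL2C.
       \<exists>\<phi>\<in>hom (homology_group 1 N) SL2C.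
         \<forall>g\<in>carrier (fundamental_group N x0). \<rho> g = \<phi> (hurewicz N g)}"

definition abelian_characters :: "'a topology \<Rightarrow> 'a \<Rightarrow> 'a character set"
  where "abelian_characters N x0 = character_of N x0 ` abelian_representations N x0"

lemma abelian_characters_subset: "abelian_characters N x0 \<subseteq> character_variety N x0"
  unfolding abelian_characters_def character_variety_def abelian_representations_def by blast


section \<open>Coordinate ring and trace ring\<close>

definition function_ring :: "'b set \<Rightarrow> ('b \<Rightarrow> complex) ring"
  where "function_ring X =
    \<lparr>carrier = X \<rightarrow>\<^sub>E UNIV,
     monoid.mult = (\<lambda>f g. \<lambda>x\<in>X. f x * g x), one = (\<lambda>x\<in>X. 1),
     zero = (\<lambda>x\<in>X. 0), add = (\<lambda>f g. \<lambda>x\<in>X. f x + g x)\<rparr>"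

definition constant_functions :: "'b set \<Rightarrow> ('b \<Rightarrow> complex) set"
  where "constant_functions X = {\<lambda>x\<in>X. c | c. True}"

definition trace_function ::
    "'a character set \<Rightarrow> (real \<Rightarrow> 'a) set \<Rightarrow> 'a character \<Rightarrow> complex"
  where "trace_function X \<gamma> = (\<lambda>x\<in>X. x \<gamma>)"

text \<open>The affine coordinates on the set of characters are the values \<open>x \<gamma>\<close> of a character \<open>x\<close> (finitely many suffice to
  generate all the others), so the coordinate ring of an algebraic subset \<open>X\<close> consists of the
  restrictions to \<open>X\<close> of the complex polynomials in these coordinates.\<close>

definition coordinate_ring ::
    "'a topology \<Rightarrow> 'a \<Rightarrow> 'a character set \<Rightarrow> ('a character \<Rightarrow> complex) ring"
  where "coordinate_ring N x0 X =
    (function_ring X)\<lparr>carrier := generate_ring (function_ring X)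
       (constant_functions X \<union> trace_function X ` carrier (fundamental_group N x0))\<rparr>"

definition trace_ring ::
    "'a topology \<Rightarrow> 'a \<Rightarrow> 'a character set \<Rightarrow> ('a character \<Rightarrow> complex) set"
  where "trace_ring N x0 X =
    generate_ring (coordinate_ring N x0 X)
      (trace_function X ` carrier (fundamental_group N x0))"

text \<open>Elements representing the same slope are conjugate up to inversion, so the choice does not
  matter.\<close>

definition slope_trace_function ::
    "'a topology \<Rightarrow> 'a \<Rightarrow> 'a character set \<Rightarrow> (real \<Rightarrow> 'a) set \<Rightarrow> 'a character \<Rightarrow> complex"
  where "slope_trace_function N x0 X \<alpha> =
    trace_function X (SOME \<gamma>. represents_slope N x0 \<gamma> \<alpha>)"


section \<open>Ranks\<close>

definition module_rank :: "('r, 's) ring_scheme \<Rightarrow> ('r, 'm, 't) module_scheme \<Rightarrow> enat"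
  where "module_rank R M =
    (INF G \<in> {G. finite G \<and> G \<subseteq> carrier M \<and>
                 (\<forall>H. submodule H R M \<longrightarrow> G \<subseteq> H \<longrightarrow> H = carrier M)}. enat (card G))"

text \<open>The additive group \<open>M\<close> inside the ring \<open>R\<close>, with scalars from \<open>R\<close> acting by multiplication.\<close>

definition module_in_ring :: "('r, 's) ring_scheme \<Rightarrow> 'r set \<Rightarrow> ('r, 'r) module"
  where "module_in_ring R M =
    \<lparr>carrier = M, monoid.mult = monoid.mult R, one = one R, zero = zero R, add = add R,
     smult = monoid.mult R\<rparr>"

definition rank_C :: "'a topology \<Rightarrow> 'a \<Rightarrow> 'a character set \<Rightarrow> (real \<Rightarrow> 'a) set \<Rightarrow> enat"
  where "rank_C N x0 X \<alpha> =
    (let R = coordinate_ring N x0 X in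
     module_rank
       (R\<lparr>carrier :=
          generate_ring R (constant_functions X \<union> {slope_trace_function N x0 X \<alpha>})\<rparr>)
       (module_in_ring R (carrier R)))"

definition rank_Z :: "'a topology \<Rightarrow> 'a \<Rightarrow> 'a character set \<Rightarrow> (real \<Rightarrow> 'a) set \<Rightarrow> enat"
  where "rank_Z N x0 X \<alpha> =
    (let R = coordinate_ring N x0 X in
     module_rank
       (R\<lparr>carrier := generate_ring R {slope_trace_function N x0 X \<alpha>}\<rparr>)
       (module_in_ring R (trace_ring N x0 X)))"

end

theory Submission
  imports Defs
begin

text \<open>Every abelian representation factors through the infinite cyclic group generated by the
  homology class of \<open>\<gamma>\<close>. Hence its character at any \<open>g\<close> is the trace of a power of a matrix in
  \<open>SL\<^sub>2\<close>, which is an integral polynomial in the trace of that matrix, that is, in \<open>I\<^sub>\<alpha>\<close>. So the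
  trace ring is \<open>\<int>[I\<^sub>\<alpha>]\<close> and the coordinate ring is \<open>\<complex>[I\<^sub>\<alpha>]\<close>, both generated by \<open>1\<close> as modules. That
  \<open>I\<^sub>\<alpha>\<close> is the same for all representatives of the slope comes from the invariance of homology
  classes under free homotopy, with reversal of the curve inverting the matrix.\<close>

section \<open>Singular chains of paths\<close>

definition path_chain :: "(real \<Rightarrow> 'a) \<Rightarrow> 'a chain"
  where "path_chain p = frag_of (path_simplex p)"

lemma path_chain_cong:
  assumes "\<And>t. t \<in> {0..1} \<Longrightarrow> p t = q t"
  shows "path_chain p = path_chain q"
proof -
  have "path_simplex p = path_simplex q"
    unfolding path_simplex_def by (rule restrict_ext) (auto simp: standard_simplex_def assms)
  then show ?thesis
    by (simp add: path_chain_def)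
qed

lemma pathin_linepath:
  assumes "convex C" "a \<in> C" "b \<in> C" "continuous_map (top_of_set C) X f"
  shows "pathin X (f \<circ> linepath a b)"
proof -
  have "continuous_map (top_of_set {0..1}) (top_of_set C) (linepath a b)"
    using assms(1-3)
    by (auto simp: continuous_map_in_subtopology linepath_def convexD_alt intro!: continuous_intros)
  then show ?thesis
    unfolding pathin_def using assms(4) continuous_map_compose by blast
qed

text \<open>The three paths bound the singular 2-simplex obtained from the affine triangle \<open>a\<close>, \<open>b\<close>, \<open>c\<close>.\<close>

lemma homologous_triangle:
  fixes C :: "'b::real_normed_vector set"
  assumes C: "convex C" "a \<in> C" "b \<in> C" "c \<in> C" and f: "continuous_map (top_of_set C) X f"
  shows "homologous_rel 1 X {}
    (path_chain (f \<circ> linepath a b) + path_chain (f \<circ> linepath b c)) (path_chain (f \<circ> linepath a c))"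
proof -
  define A where "A = (\<lambda>x::nat \<Rightarrow> real. x 0 *\<^sub>R a + x 1 *\<^sub>R b + x 2 *\<^sub>R c)"
  define \<sigma> where "\<sigma> = restrict (f \<circ> A) (standard_simplex 2)"
  have "continuous_on (standard_simplex 2) (\<lambda>x. x i :: real)" for i
    by (rule continuous_on_subset[OF continuous_on_product_coordinates]) simp
  then have "continuous_on (standard_simplex 2) A"
    unfolding A_def by (intro continuous_intros)
  moreover have "A x \<in> C" if "x \<in> standard_simplex 2" for x
  proof -
    have "x 0 + x 1 + x 2 = 1" "0 \<le> x 0" "0 \<le> x 1" "0 \<le> x 2"
      using that by (auto simp: standard_simplex_def numeral_2_eq_2)
    then show ?thesis
      using C convex_hull_3[of a b c] hull_minimal[of "{a, b, c}" C convex]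
      unfolding A_def by blast
  qed
  ultimately have "continuous_map (subtopology (powertop_real UNIV) (standard_simplex 2)) (top_of_set C) A"
    by (auto simp: continuous_map_in_subtopology euclidean_product_topology)
  from continuous_map_compose[OF this f]
  have "continuous_map (subtopology (powertop_real UNIV) (standard_simplex 2)) X \<sigma>"
    by (rule continuous_map_eq) (simp add: \<sigma>_def)
  then have \<sigma>: "singular_simplex 2 X \<sigma>"
    unfolding singular_simplex_def \<sigma>_def by auto
  \<comment> \<open>\<open>path_simplex\<close> is parametrised by \<open>x 1\<close>, so each face
    is identified by writing \<open>A\<close> on it as a linear path in \<open>x 1\<close>; the
    premises on \<open>x 0\<close> and \<open>x 2\<close> hold on the standard 1-simplex.\<close>
  have face: "singular_face 2 k \<sigma> = path_simplex (f \<circ> linepath u v)"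
    if "\<And>x. x 0 = 1 - x 1 \<Longrightarrow> x 2 = 0 \<Longrightarrow> A (simplical_face k x) = linepath u v (x 1)" "k \<le> 2" for k u v
  proof -
    have "\<sigma> (simplical_face k x) = f (linepath u v (x 1))" if x: "x \<in> standard_simplex 1" for x
    proof -
      have "x 0 = 1 - x 1" "x 2 = 0"
        using x by (auto simp: standard_simplex_def)
      moreover have "simplical_face k x \<in> standard_simplex 2"
        using simplical_face_in_standard_simplex[of 2 k x] x \<open>k \<le> 2\<close> by simp
      ultimately show ?thesis
        unfolding \<sigma>_def using that(1) \<open>\<And>x. _ \<Longrightarrow> _ \<Longrightarrow> A (simplical_face k x) = _\<close> by simp
    qed
    then show ?thesis
      unfolding singular_face_def path_simplex_def by (auto intro: restrict_ext)
  qed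
  have "singular_face 2 0 \<sigma> = path_simplex (f \<circ> linepath b c)"
    "singular_face 2 1 \<sigma> = path_simplex (f \<circ> linepath a c)"
    "singular_face 2 2 \<sigma> = path_simplex (f \<circ> linepath a b)"
    by (rule face; simp add: A_def simplical_face_def linepath_def)+
  \<comment> \<open>Faces 0, 1, 2 are the edges bc, ac, ab and enter the boundary with signs +, -,
    +.\<close>
  then have "chain_boundary 2 (frag_of \<sigma>) =
      path_chain (f \<circ> linepath a b) + path_chain (f \<circ> linepath b c) - path_chain (f \<circ> linepath a c)"
    by (simp add: chain_boundary_of numeral_2_eq_2 path_chain_def)
  then show ?thesis
    unfolding homologous_rel_def singular_boundary
    by (metis \<sigma> singular_chain_of Suc_1 One_nat_def)
qed

text \<open>A triangle with all vertices equal shows twice the chain to be homologous to the chain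
  itself, and one copy cancels.\<close>

lemma homologous_const_path:
  assumes "y \<in> topspace X"
  shows "homologous_rel 1 X {} (path_chain (\<lambda>_. y)) 0"
proof -
  have "homologous_rel 1 X {} (path_chain (\<lambda>_. y) + path_chain (\<lambda>_. y)) (path_chain (\<lambda>_. y))"
    using homologous_triangle[of UNIV "0::real" 0 0 X "\<lambda>_. y"] assms by (simp add: o_def)
  then show ?thesis
    by (simp add: homologous_rel_def)
qed

section \<open>Concatenation and reversal of paths in homology\<close>

lemma pathin_path_concat:
  assumes "pathin X p" "pathin X q" "p 1 = q 0"
  shows "pathin X (path_concat p q)"
  unfolding pathin_def path_concat_def
proof (rule continuous_map_cases_le)
  have p: "continuous_map (top_of_set {0..1}) X p" and q: "continuous_map (top_of_set {0..1}) X q"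
    using assms by (auto simp: pathin_def)
  have "continuous_map (subtopology (top_of_set {0..1}) {x \<in> topspace (top_of_set {0..1}). x \<le> 1/2})
      (top_of_set {0..1::real}) (\<lambda>x. 2 * x)"
    by (auto simp: continuous_map_in_subtopology subtopology_subtopology intro!: continuous_intros)
  from continuous_map_compose[OF this p]
  show "continuous_map (subtopology (top_of_set {0..1}) {x \<in> topspace (top_of_set {0..1}). x \<le> 1/2})
      X (\<lambda>x. p (2 * x))"
    by (simp add: o_def)
  have "continuous_map (subtopology (top_of_set {0..1}) {x \<in> topspace (top_of_set {0..1}). 1/2 \<le> x})
      (top_of_set {0..1::real}) (\<lambda>x. 2 * x - 1)"
    by (auto simp: continuous_map_in_subtopology subtopology_subtopology intro!: continuous_intros)
  from continuous_map_compose[OF this q]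
  show "continuous_map (subtopology (top_of_set {0..1}) {x \<in> topspace (top_of_set {0..1}). 1/2 \<le> x})
      X (\<lambda>x. q (2 * x - 1))"
    by (simp add: o_def)
qed (use assms in \<open>auto simp: field_simps\<close>)

lemma pathin_path_reverse:
  assumes "pathin X p"
  shows "pathin X (path_reverse p)"
  using pathin_linepath[of "{0..1}" 1 0 X p] assms
  by (simp add: pathin_def path_reverse_def o_def linepath_def)

lemma path_reverse_path_reverse [simp]: "path_reverse (path_reverse p) = p"
  by (simp add: path_reverse_def)

text \<open>The flat triangle 0, 1/2, 1 in the unit interval, mapped by the concatenated path, has
  edges that reparametrise \<open>p\<close>, \<open>q\<close> and the whole path.\<close>

lemma homologous_path_concat:
  assumes "pathin X p" "pathin X q" "p 1 = q 0"
  shows "homologous_rel 1 X {} (path_chain (path_concat p q)) (path_chain p + path_chain q)"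
proof -
  have "homologous_rel 1 X {}
      (path_chain (path_concat p q \<circ> linepath 0 (1/2)) + path_chain (path_concat p q \<circ> linepath (1/2) 1))
      (path_chain (path_concat p q \<circ> linepath 0 1))"
    by (rule homologous_triangle[of "{0..1}"])
      (use pathin_path_concat[OF assms] in \<open>auto simp: pathin_def\<close>)
  moreover have "path_chain (path_concat p q \<circ> linepath 0 (1/2)) = path_chain p"
    by (rule path_chain_cong) (auto simp: path_concat_def linepath_def)
  moreover have "path_chain (path_concat p q \<circ> linepath (1/2) 1) = path_chain q"
  proof (rule path_chain_cong)
    \<comment> \<open>At \<open>t = 0\<close> the point 1/2 falls into the first branch of
      \<open>path_concat\<close>, with value \<open>p 1\<close>; there the matching of end points is
      used.\<close>
    fix t :: real assume "t \<in> {0..1}"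
    then show "(path_concat p q \<circ> linepath (1/2) 1) t = q t"
      using \<open>p 1 = q 0\<close> by (cases "t = 0") (auto simp: path_concat_def linepath_def field_simps)
  qed
  moreover have "path_chain (path_concat p q \<circ> linepath 0 1) = path_chain (path_concat p q)"
    by (rule path_chain_cong) (auto simp: linepath_def)
  ultimately show ?thesis
    by (simp add: homologous_rel_sym)
qed

text \<open>In the flat triangle 0, 1, 0 the edges are \<open>p\<close>, its reverse and a constant
  path, which is null-homologous.\<close>

lemma homologous_path_reverse:
  assumes "pathin X p"
  shows "homologous_rel 1 X {} (path_chain (path_reverse p)) (- path_chain p)"
proof -
  have "homologous_rel 1 X {}
      (path_chain (p \<circ> linepath 0 1) + path_chain (p \<circ> linepath 1 0)) (path_chain (p \<circ> linepath 0 0))"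
    by (rule homologous_triangle[of "{0..1}"]) (use assms in \<open>auto simp: pathin_def\<close>)
  moreover have "path_chain (p \<circ> linepath 0 1) = path_chain p"
    "path_chain (p \<circ> linepath 1 0) = path_chain (path_reverse p)"
    by (rule path_chain_cong; simp add: linepath_def path_reverse_def)+
  moreover have "p 0 \<in> topspace X"
    using assms path_start_in_topspace by blast
  then have "homologous_rel 1 X {} (path_chain (p \<circ> linepath 0 0)) 0"
    using homologous_const_path[of "p 0" X] by (simp add: o_def linepath_refl)
  ultimately have "homologous_rel 1 X {} (path_chain p + path_chain (path_reverse p)) 0"
    using homologous_rel_trans by fastforce
  then show ?thesis
    by (simp add: homologous_rel_def add.commute)
qed

section \<open>Loops up to free homotopy\<close>

definition freely_homotopic_loops :: "'a topology \<Rightarrow> (real \<Rightarrow> 'a) \<Rightarrow> (real \<Rightarrow> 'a) \<Rightarrow> bool"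
  where "freely_homotopic_loops X p q \<longleftrightarrow> homotopic_with (\<lambda>r. r 0 = r 1) (top_of_set {0..1}) X p q"

lemma freely_homotopic_loops_imp_loops:
  assumes "freely_homotopic_loops X p q"
  shows "pathin X p" "pathin X q" "p 0 = p 1" "q 0 = q 1"
  using homotopic_with_imp_continuous_maps[OF assms[unfolded freely_homotopic_loops_def]]
    homotopic_with_imp_property[OF assms[unfolded freely_homotopic_loops_def]]
  by (auto simp: pathin_def)

text \<open>The homotopy square is cut along its diagonal into two triangles. The track of the
  moving base point is an edge of both and cancels.\<close>

lemma freely_homotopic_loops_imp_homologous:
  assumes "freely_homotopic_loops X p q"
  shows "homologous_rel 1 X {} (path_chain p) (path_chain q)"
proof -
  obtain h where "continuous_map (prod_topology (top_of_set {0..1::real}) (top_of_set {0..1})) X h"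
    and p: "\<forall>t. h (0, t) = p t" and q: "\<forall>t. h (1, t) = q t"
    and loop: "\<forall>s\<in>{0..1}. h (s, 0) = h (s, 1)"
    using assms unfolding freely_homotopic_loops_def homotopic_with_def by blast
  \<comment> \<open>The product of intervals is read as a convex subset of the plane, as the
    triangle relation requires.\<close>
  then have h: "continuous_map (top_of_set ({0..1} \<times> {0..1})) X h"
    by (simp only: subtopology_Times prod_topology_euclidean[symmetric])
  have sq: "convex ({0..1::real} \<times> {0..1::real})"
    by (simp add: convex_Times)
  let ?diagonal = "path_chain (h \<circ> linepath (0, 0) (1, 1))"
  let ?top = "path_chain (h \<circ> linepath (0, 1) (1, 1))"
  \<comment> \<open>Every stage of the homotopy is a loop, so both ends of the loops trace the same
    path, called \<open>?top\<close>.\<close>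
  have edges: "path_chain (h \<circ> linepath (0, 0) (0, 1)) = path_chain p"
    "path_chain (h \<circ> linepath (1, 0) (1, 1)) = path_chain q"
    "path_chain (h \<circ> linepath (0, 0) (1, 0)) = ?top"
    by (rule path_chain_cong; simp add: linepath_def p q loop)+
  have "homologous_rel 1 X {} (path_chain p + ?top) ?diagonal"
    using homologous_triangle[OF sq _ _ _ h, of "(0, 0)" "(0, 1)" "(1, 1)"] by (simp add: edges)
  moreover have "homologous_rel 1 X {} (?top + path_chain q) ?diagonal"
    using homologous_triangle[OF sq _ _ _ h, of "(0, 0)" "(1, 0)" "(1, 1)"] by (simp add: edges)
  ultimately have "homologous_rel 1 X {} (path_chain p + ?top) (?top + path_chain q)"
    using homologous_rel_sym homologous_rel_trans by blast
  then show ?thesis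
    by (simp add: homologous_rel_def)
qed

section \<open>Loops as cycles and the Hurewicz map\<close>

lemma singular_relcycle_path_chain:
  assumes "pathin X p" "p 0 = p 1"
  shows "singular_relcycle 1 X {} (path_chain p)"
proof -
  have "continuous_on (standard_simplex 1) (\<lambda>x. x 1 :: real)"
    by (rule continuous_on_subset[OF continuous_on_product_coordinates]) simp
  then have "continuous_map (subtopology (powertop_real UNIV) (standard_simplex 1))
      (top_of_set {0..1}) (\<lambda>x. x 1)"
    by (auto simp: continuous_map_in_subtopology euclidean_product_topology standard_simplex_def)
  from continuous_map_compose[OF this assms(1)[unfolded pathin_def]]
  have "continuous_map (subtopology (powertop_real UNIV) (standard_simplex 1)) X (path_simplex p)"
    by (rule continuous_map_eq) (simp add: path_simplex_def)
  then have "singular_simplex 1 X (path_simplex p)"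
    unfolding singular_simplex_def by (auto simp: path_simplex_def)
  \<comment> \<open>Both faces are the common end point of the loop, so they cancel in the
    boundary.\<close>
  moreover have "singular_face 1 0 (path_simplex p) = singular_face 1 1 (path_simplex p)"
    unfolding singular_face_def
  proof (rule restrict_ext)
    fix x assume "x \<in> standard_simplex (1 - Suc 0)"
    then have x: "x = (\<lambda>j. if j = 0 then 1 else 0)"
      by (simp add: standard_simplex_0)
    have "simplical_face 0 x \<in> standard_simplex 1" "simplical_face 1 x \<in> standard_simplex 1"
      using simplical_face_in_standard_simplex[of 1 _ x] x by (auto simp: standard_simplex_0)
    then show "(path_simplex p \<circ> simplical_face 0) x = (path_simplex p \<circ> simplical_face 1) x"
      by (simp add: path_simplex_def simplical_face_def x assms(2))
  qed
  then have "chain_boundary 1 (path_chain p) = 0"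
    by (simp add: chain_boundary_of path_chain_def)
  ultimately show ?thesis
    by (simp add: singular_cycle path_chain_def singular_chain_of)
qed

text \<open>This removes the choice operator: the chosen representative is path homotopic to the
  loop \<open>p\<close>, hence freely homotopic and homologous to it.\<close>

lemma hurewicz_path_class:
  assumes "pathin X p" "p 0 = p 1"
  shows "hurewicz X (path_class X p) = homologous_rel_set 1 X {} (path_chain p)"
proof -
  define q where "q = (SOME q. q \<in> path_class X p)"
  have "p \<in> path_class X p"
    using assms by (simp add: path_class_def path_homotopic_def pathin_def)
  then have "q \<in> path_class X p"
    unfolding q_def by (rule someI[where P = "\<lambda>q. q \<in> path_class X p"])
  then have "freely_homotopic_loops X p q"
    unfolding path_class_def path_homotopic_def freely_homotopic_loops_def
    using assms(2) by (auto elim: homotopic_with_mono)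
  then have "homologous_rel 1 X {} (path_chain p) (path_chain q)"
    by (rule freely_homotopic_loops_imp_homologous)
  then show ?thesis
    unfolding hurewicz_def q_def[symmetric] path_chain_def[symmetric]
    by (metis homologous_rel_eq)
qed

lemma hurewicz_in_homology_group:
  assumes "g \<in> carrier (fundamental_group X x0)"
  shows "hurewicz X g \<in> carrier (homology_group 1 X)"
proof -
  obtain p where p: "g = path_class X p" "pathin X p" "p 0 = p 1"
    using assms by (auto simp: fundamental_group_def)
  then show ?thesis
    using singular_relcycle_path_chain[OF p(2,3)] carrier_relative_homology_group[of 1 X "{}"]
    by (simp add: hurewicz_path_class)
qed

text \<open>In homology the tether \<open>t\<close> and its reverse cancel. Loops of this shape are
  the ones that represent slopes.\<close>

lemma tethered_loop:
  assumes "pathin X c" "c 0 = c 1" "pathin X t" "t 1 = c 0"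
  defines "l \<equiv> path_concat t (path_concat c (path_reverse t))"
  shows "pathin X l" "l 0 = t 0" "l 1 = t 0" "homologous_rel 1 X {} (path_chain l) (path_chain c)"
proof -
  have rt: "pathin X (path_reverse t)" "c 1 = path_reverse t 0"
    using assms pathin_path_reverse[of X t] by (simp_all add: path_reverse_def)
  have ct: "pathin X (path_concat c (path_reverse t))" "t 1 = path_concat c (path_reverse t) 0"
    using assms(1,4) rt pathin_path_concat[of X c "path_reverse t"] by (simp_all add: path_concat_def)
  show "pathin X l" "l 0 = t 0" "l 1 = t 0"
    unfolding l_def using pathin_path_concat[OF assms(3) ct]
    by (simp_all add: path_concat_def path_reverse_def)
  have "homologous_rel 1 X {} (path_chain l) (path_chain t + path_chain (path_concat c (path_reverse t)))"
    unfolding l_def using assms(3) ct by (rule homologous_path_concat)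
  moreover have "homologous_rel 1 X {} (path_chain (path_concat c (path_reverse t)))
      (path_chain c + path_chain (path_reverse t))"
    using assms(1) rt by (rule homologous_path_concat)
  moreover have "homologous_rel 1 X {} (path_chain (path_reverse t)) (- path_chain t)"
    using assms(3) by (rule homologous_path_reverse)
  ultimately have "homologous_rel 1 X {} (path_chain l) (path_chain t + (path_chain c + - path_chain t))"
    by (meson homologous_rel_add homologous_rel_refl homologous_rel_trans)
  then show "homologous_rel 1 X {} (path_chain l) (path_chain c)"
    by simp
qed

lemma homologous_rel_uminus:
  assumes "homologous_rel p X S a b"
  shows "homologous_rel p X S (- a) (- b)"
  using homologous_rel_diff[OF homologous_rel_refl[of p X S 0] assms] by simp

section \<open>Slopes\<close>

text \<open>The isotopy loses its injectivity condition and is composed with the inclusion of the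
  boundary.\<close>

lemma isotopic_curves_imp_freely_homotopic:
  assumes "isotopic_curves (boundary_space N) c d"
  shows "freely_homotopic_loops N c d"
proof -
  have "homotopic_with (\<lambda>r. r 0 = r 1) (top_of_set {0..1}) (boundary_space N) c d"
    using assms unfolding isotopic_curves_def by (rule homotopic_with_mono) auto
  then have "homotopic_with (\<lambda>r. r 0 = r 1) (top_of_set {0..1}) N (id \<circ> c) (id \<circ> d)"
    by (rule homotopic_with_compose_continuous_map_left) 
      (auto simp: continuous_map_from_subtopology)
  then show ?thesis
    by (simp add: freely_homotopic_loops_def)
qed

text \<open>The sign reflects that slopes are unoriented: a curve whose reverse is isotopic to
  \<open>c\<close> has the opposite class.\<close>

lemma slope_curve:
  assumes "d \<in> unoriented_isotopy_class (boundary_space N) c"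
  shows "pathin N d" "d 0 = d 1"
    "homologous_rel 1 N {} (path_chain d) (path_chain c) \<or>
     homologous_rel 1 N {} (path_chain d) (- path_chain c)"
proof -
  have "freely_homotopic_loops N c d \<or> freely_homotopic_loops N c (path_reverse d)"
    using assms isotopic_curves_imp_freely_homotopic unfolding unoriented_isotopy_class_def by blast
  then have "pathin N d \<and> d 0 = d 1 \<and>
    (homologous_rel 1 N {} (path_chain d) (path_chain c) \<or>
     homologous_rel 1 N {} (path_chain d) (- path_chain c))"
  proof
    assume "freely_homotopic_loops N c d"
    then show ?thesis
      using freely_homotopic_loops_imp_loops freely_homotopic_loops_imp_homologous homologous_rel_sym
      by metis
  next
    assume *: "freely_homotopic_loops N c (path_reverse d)"
    \<comment> \<open>\<open>d\<close> is the reverse of \<open>path_reverse d\<close> and inherits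
      its continuity.\<close>
    have d: "pathin N d" "d 0 = d 1"
      using freely_homotopic_loops_imp_loops(2,4)[OF *] pathin_path_reverse[of N "path_reverse d"]
      by (simp, simp add: path_reverse_def)
    have "homologous_rel 1 N {} (path_chain c) (- path_chain d)"
      using freely_homotopic_loops_imp_homologous[OF *] homologous_path_reverse[OF d(1)]
      by (metis homologous_rel_trans)
    then have "homologous_rel 1 N {} (- path_chain c) (path_chain d)"
      using homologous_rel_uminus by fastforce
    then show ?thesis
      using d by (simp add: homologous_rel_sym)
  qed
  then show "pathin N d" "d 0 = d 1"
    "homologous_rel 1 N {} (path_chain d) (path_chain c) \<or>
     homologous_rel 1 N {} (path_chain d) (- path_chain c)"
    by blast+
qed

text \<open>Homology classes are cosets of boundaries and the group inverse negates a coset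
  elementwise; this turns signs of chains into inverses.\<close>

lemma homologous_rel_set_uminus:
  assumes "singular_relcycle 1 X {} a"
  shows "homologous_rel_set 1 X {} (- a) = inv\<^bsub>homology_group 1 X\<^esub> (homologous_rel_set 1 X {} a)"
proof -
  have "homologous_rel_set 1 X {} a \<in> carrier (homology_group (int 1) X)"
    using assms carrier_relative_homology_group[of 1 X "{}"] by blast
  then have "inv\<^bsub>homology_group 1 X\<^esub> (homologous_rel_set 1 X {} a) = uminus ` homologous_rel_set 1 X {} a"
    using inv_relative_homology_group[of _ 1 X "{}"] by simp
  also have "\<dots> = homologous_rel_set 1 X {} (- a)"
    using homologous_rel_uminus[of 1 X "{}" a] homologous_rel_uminus[of 1 X "{}" "- a"]
    by (force simp: image_iff)
  finally show ?thesis ..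
qed

text \<open>Every representative is compared with the same curve \<open>c\<close>, so that two
  representatives can then be compared with each other.\<close>

lemma represents_slope_loop:
  assumes "represents_slope N x0 \<gamma> (unoriented_isotopy_class (boundary_space N) c)"
  shows "\<exists>l. l 0 = x0 \<and> l 1 = x0 \<and> pathin N l \<and> \<gamma> = path_class N l \<and>
      (homologous_rel 1 N {} (path_chain l) (path_chain c) \<or>
       homologous_rel 1 N {} (path_chain l) (- path_chain c))"
proof -
  obtain d t where d: "d \<in> unoriented_isotopy_class (boundary_space N) c"
    and t: "pathin N t" "t 0 = x0" "t 1 = d 0"
    and \<gamma>: "\<gamma> = path_class N (path_concat t (path_concat d (path_reverse t)))"
    using assms unfolding represents_slope_def by blast
  note d' = slope_curve[OF d]
  note l = tethered_loop[OF d'(1,2) t(1,3)]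
  show ?thesis
    using l d'(3) t(2) \<gamma> homologous_rel_trans by (metis (no_types, lifting))
qed

lemma represents_slope_in_fundamental_group:
  assumes "\<alpha> \<in> slopes N" "represents_slope N x0 \<gamma> \<alpha>"
  shows "\<gamma> \<in> carrier (fundamental_group N x0)"
proof -
  obtain c where "\<alpha> = unoriented_isotopy_class (boundary_space N) c"
    using assms(1) by (auto simp: slopes_def)
  then obtain l where "l 0 = x0" "l 1 = x0" "pathin N l" "\<gamma> = path_class N l"
    using represents_slope_loop assms(2) by metis
  then show ?thesis
    by (auto simp: fundamental_group_def)
qed

text \<open>Both loops are homologous to the same curve up to sign. This controls the arbitrary
  choice made in \<open>slope_trace_function\<close>.\<close>

lemma represents_slope_unique_up_to_inverse:
  assumes "\<alpha> \<in> slopes N" "represents_slope N x0 \<gamma> \<alpha>" "represents_slope N x0 \<delta> \<alpha>"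
  shows "hurewicz N \<delta> = hurewicz N \<gamma> \<or> hurewicz N \<delta> = inv\<^bsub>homology_group 1 N\<^esub> (hurewicz N \<gamma>)"
proof -
  obtain c where \<alpha>: "\<alpha> = unoriented_isotopy_class (boundary_space N) c"
    using assms(1) by (auto simp: slopes_def)
  obtain l where l: "l 0 = x0" "l 1 = x0" "pathin N l" "\<gamma> = path_class N l"
    and lc: "homologous_rel 1 N {} (path_chain l) (path_chain c) \<or>
       homologous_rel 1 N {} (path_chain l) (- path_chain c)"
    using represents_slope_loop[OF assms(2)[unfolded \<alpha>]] by blast
  obtain m where m: "m 0 = x0" "m 1 = x0" "pathin N m" "\<delta> = path_class N m"
    and mc: "homologous_rel 1 N {} (path_chain m) (path_chain c) \<or>
       homologous_rel 1 N {} (path_chain m) (- path_chain c)"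
    using represents_slope_loop[OF assms(3)[unfolded \<alpha>]] by blast
  have "homologous_rel 1 N {} (path_chain m) (path_chain l) \<or>
      homologous_rel 1 N {} (path_chain m) (- path_chain l)"
    using lc mc by (metis homologous_rel_uminus add.inverse_inverse homologous_rel_sym homologous_rel_trans)
  then have "homologous_rel_set 1 N {} (path_chain m) = homologous_rel_set 1 N {} (path_chain l) \<or>
      homologous_rel_set 1 N {} (path_chain m) = homologous_rel_set 1 N {} (- path_chain l)"
    by (metis homologous_rel_eq)
  then show ?thesis
    using l m hurewicz_path_class[of N l] hurewicz_path_class[of N m]
      homologous_rel_set_uminus[OF singular_relcycle_path_chain[of N l]] by metis
qed

section \<open>Traces of powers\<close>

text \<open>Powers of a matrix in \<open>SL\<^sub>2\<close> with trace \<open>z\<close> have trace \<open>trace_poly n z\<close>, by Cayley-Hamilton;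
  these are the Chebyshev polynomials in the normalisation \<open>2 T\<^sub>n (z / 2)\<close>.\<close>

fun trace_poly :: "nat \<Rightarrow> complex \<Rightarrow> complex" where
  "trace_poly 0 z = 2"
| "trace_poly (Suc 0) z = z"
| "trace_poly (Suc (Suc n)) z = z * trace_poly (Suc n) z - trace_poly n z"

lemma group_SL2C: "group SL2C"
proof (rule groupI)
  fix A assume "A \<in> carrier SL2C"
  then have A: "det A = 1"
    by (simp add: SL2C_def)
  then obtain B where B: "B ** A = mat 1"
    using invertible_det_nz[of A] unfolding invertible_def by auto
  then have "det B = 1"
    using det_mul[of B A] A by simp
  then show "\<exists>B\<in>carrier SL2C. B \<otimes>\<^bsub>SL2C\<^esub> A = \<one>\<^bsub>SL2C\<^esub>"
    using B by (auto simp: SL2C_def)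
qed (auto simp: SL2C_def det_mul matrix_mul_assoc)

text \<open>This is Cayley-Hamilton for \<open>A\<close>, multiplied by \<open>B\<close> from the
  left and traced. For \<open>B\<close> a power of \<open>A\<close> it is the recursion of
  \<open>trace_poly\<close>.\<close>

lemma trace_mult_SL2C:
  fixes A B :: "complex^2^2"
  assumes "det A = 1"
  shows "trace (B ** A ** A) = trace A * trace (B ** A) - trace B"
proof -
  \<comment> \<open>Inserting the determinant as a factor leaves a polynomial identity in the matrix
    entries.\<close>
  have "trace B = trace B * (A $ 1 $ 1 * A $ 2 $ 2 - A $ 1 $ 2 * A $ 2 $ 1)"
    using assms by (simp add: det_2)
  then show ?thesis
    by (simp add: trace_def matrix_matrix_mult_def sum_2 algebra_simps)
qed

text \<open>As \<open>B ** A\<close> is the identity, of trace 2, the preceding relation reads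
  \<open>trace A = 2 * trace A - trace B\<close>.\<close>

lemma trace_inverse_SL2C:
  fixes A B :: "complex^2^2"
  assumes "det A = 1" "B ** A = mat 1"
  shows "trace B = trace A"
proof -
  have "trace (A ** B) = 2"
    using assms(2) trace_mul_sym[of A B] by (simp add: trace_I)
  have "trace (B ** A ** A) = trace A * 2 - trace B"
    using trace_mult_SL2C[OF assms(1), of B] assms(2) by (simp add: trace_I)
  then show ?thesis
    using assms(2) by simp
qed

lemma trace_nat_pow_SL2C:
  assumes "A \<in> carrier SL2C"
  shows "trace (A [^]\<^bsub>SL2C\<^esub> (n::nat)) = trace_poly n (trace A)"
proof (induction n "trace A" rule: trace_poly.induct)
  case 1
  then show ?case
    by (simp add: SL2C_def nat_pow_def trace_I)
next
  case 2
  then show ?case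
    using assms group.is_monoid[OF group_SL2C] by (simp add: monoid.nat_pow_eone)
next
  \<comment> \<open>Powers multiply on the right, so the power \<open>n + 2\<close> is
    \<open>B ** A ** A\<close> with \<open>B\<close> the power \<open>n\<close>.\<close>
  case (3 n)
  then show ?case
    using assms trace_mult_SL2C[of A "A [^]\<^bsub>SL2C\<^esub> n"] by (simp add: SL2C_def nat_pow_def)
qed

text \<open>A matrix and its inverse have the same trace, so negative exponents reduce to positive
  ones.\<close>

lemma trace_int_pow_SL2C:
  assumes "A \<in> carrier SL2C"
  shows "trace (A [^]\<^bsub>SL2C\<^esub> (k::int)) = trace_poly (nat \<bar>k\<bar>) (trace A)"
proof -
  interpret group SL2C
    by (rule group_SL2C)
  have inv: "trace (inv\<^bsub>SL2C\<^esub> B) = trace B" if B: "B \<in> carrier SL2C" for B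
    using trace_inverse_SL2C[of B "inv\<^bsub>SL2C\<^esub> B"] l_inv[OF B] B by (simp add: SL2C_def)
  show ?thesis
  proof (cases "k < 0")
    case True
    then have "A [^]\<^bsub>SL2C\<^esub> k = inv\<^bsub>SL2C\<^esub> (A [^]\<^bsub>SL2C\<^esub> nat \<bar>k\<bar>)"
      using int_pow_def2[of SL2C A k] by simp
    then show ?thesis
      using assms inv[of "A [^]\<^bsub>SL2C\<^esub> nat \<bar>k\<bar>"] trace_nat_pow_SL2C[of A "nat \<bar>k\<bar>"]
      by (metis nat_pow_closed)
  next
    case False
    then have "A [^]\<^bsub>SL2C\<^esub> k = A [^]\<^bsub>SL2C\<^esub> nat \<bar>k\<bar>"
      using int_pow_def2[of SL2C A k] by simp
    then show ?thesis
      using trace_nat_pow_SL2C[OF assms] by metis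
  qed
qed

section \<open>Rings of functions\<close>

lemma ring_function_ring: "ring (function_ring X)"
proof (rule ringI)
  show "abelian_group (function_ring X)"
  proof (rule abelian_groupI)
    fix f assume "f \<in> carrier (function_ring X)"
    then have "(\<lambda>x\<in>X. - f x) \<oplus>\<^bsub>function_ring X\<^esub> f = \<zero>\<^bsub>function_ring X\<^esub>"
      by (auto simp: function_ring_def)
    then show "\<exists>g\<in>carrier (function_ring X). g \<oplus>\<^bsub>function_ring X\<^esub> f = \<zero>\<^bsub>function_ring X\<^esub>"
      by (rule bexI[where x = "\<lambda>x\<in>X. - f x"]) (auto simp: function_ring_def)
  qed (auto simp: function_ring_def restrict_def PiE_iff extensional_def ac_simps)
next
  show "monoid (function_ring X)"
    by (rule monoidI) (auto simp: function_ring_def restrict_def PiE_iff extensional_def ac_simps)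
next
  fix f g h
  show "(f \<oplus>\<^bsub>function_ring X\<^esub> g) \<otimes>\<^bsub>function_ring X\<^esub> h =
      f \<otimes>\<^bsub>function_ring X\<^esub> h \<oplus>\<^bsub>function_ring X\<^esub> g \<otimes>\<^bsub>function_ring X\<^esub> h"
    by (rule ext) (simp add: function_ring_def distrib_right)
  show "h \<otimes>\<^bsub>function_ring X\<^esub> (f \<oplus>\<^bsub>function_ring X\<^esub> g) =
      h \<otimes>\<^bsub>function_ring X\<^esub> f \<oplus>\<^bsub>function_ring X\<^esub> h \<otimes>\<^bsub>function_ring X\<^esub> g"
    by (rule ext) (simp add: function_ring_def distrib_left)
qed

text \<open>The recursion of \<open>trace_poly\<close> subtracts, so the abstract additive inverse
  has to be made pointwise.\<close>

lemma a_inv_function_ring: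
  assumes "f \<in> carrier (function_ring X)"
  shows "\<ominus>\<^bsub>function_ring X\<^esub> f = (\<lambda>x\<in>X. - f x)"
proof -
  interpret ring "function_ring X"
    by (rule ring_function_ring)
  show ?thesis
    by (rule minus_equality) (use assms in \<open>auto simp: function_ring_def\<close>)
qed

text \<open>The polynomials have integer coefficients, so sums, products and negatives of
  \<open>f\<close> and the unit suffice. Without complex constants among the generators, the result
  also serves the rank over the integers.\<close>

lemma trace_poly_in_generate_ring:
  assumes "f \<in> carrier (function_ring X)"
  shows "(\<lambda>x\<in>X. trace_poly n (f x)) \<in> generate_ring (function_ring X) {f}"
proof (induction n rule: induct_nat_012)
  case 0
  \<comment> \<open>The constant 2 is built from the ring unit, since the only generator is
    \<open>f\<close>.\<close>
  have "(\<lambda>x\<in>X. trace_poly 0 (f x)) = \<one>\<^bsub>function_ring X\<^esub> \<oplus>\<^bsub>function_ring X\<^esub> \<one>\<^bsub>function_ring X\<^esub>"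
    by (auto simp: function_ring_def)
  then show ?case
    by (metis generate_ring.eng_add generate_ring.one)
next
  case 1
  have "(\<lambda>x\<in>X. trace_poly (Suc 0) (f x)) = f"
    using assms by (simp add: function_ring_def PiE_restrict)
  then show ?case
    by (simp add: generate_ring.incl)
next
  case (ge2 n)
  let ?p = "\<lambda>n. \<lambda>x\<in>X. trace_poly n (f x)"
  have "?p n \<in> carrier (function_ring X)"
    by (auto simp: function_ring_def)
  then have "?p (Suc (Suc n)) =
      f \<otimes>\<^bsub>function_ring X\<^esub> ?p (Suc n) \<oplus>\<^bsub>function_ring X\<^esub> \<ominus>\<^bsub>function_ring X\<^esub> ?p n"
    by (simp add: a_inv_function_ring) (auto simp: function_ring_def)
  moreover have "f \<in> generate_ring (function_ring X) {f}"
    by (simp add: generate_ring.incl)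
  ultimately show ?case
    using ge2 by (metis generate_ring.eng_add generate_ring.eng_mult generate_ring.a_inv)
qed

text \<open>The scalar rings and the trace ring are generated inside the coordinate ring; this moves
  the computation to the full function ring.\<close>

lemma (in ring) generate_ring_subring:
  assumes "subring H R" "K \<subseteq> H"
  shows "generate_ring (R\<lparr>carrier := H\<rparr>) K = generate_ring R K"
proof -
  have "K \<subseteq> carrier R"
    using assms subringE(1) by blast
  then show ?thesis
    using subring_gen_incl[of H "carrier R" K] subring_gen_incl[of "carrier R" H K] assms carrier_is_subring
    by auto
qed

text \<open>Used to replace all trace functions by a single one, with and without the
  constants.\<close>

lemma (in ring) generate_ring_eqI:
  assumes "H \<subseteq> carrier R" "K \<subseteq> H" "H \<subseteq> generate_ring R K"
  shows "generate_ring R K = generate_ring R H"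
  using assms generate_ring_min_subring1[of H "generate_ring R K"] generate_ring_is_subring[of K] mono_generate_ring
  by (metis order_trans subset_antisym)

text \<open>The unit generates because \<open>r\<close> is \<open>r\<close> times the unit. Rank 0
  would make the zero submodule everything, which a nonzero unit forbids.\<close>

lemma (in ring) module_rank_self:
  assumes S: "subring S R" and "\<one> \<noteq> \<zero>"
  shows "module_rank (R\<lparr>carrier := S\<rparr>) (module_in_ring R S) = 1"
  unfolding module_rank_def
proof (rule antisym)
  let ?M = "module_in_ring R S"
  let ?generates = "\<lambda>G. \<forall>H. submodule H (R\<lparr>carrier := S\<rparr>) ?M \<longrightarrow> G \<subseteq> H \<longrightarrow> H = carrier ?M"
  have "?generates {\<one>}"
  proof (intro allI impI)
    fix H assume "submodule H (R\<lparr>carrier := S\<rparr>) ?M" and one: "{\<one>} \<subseteq> H"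
    then interpret submodule H "R\<lparr>carrier := S\<rparr>" ?M
      by simp
    have "r \<in> H" if "r \<in> S" for r
      using smult_closed[of r \<one>] that one subringE(1)[OF S] by (auto simp: module_in_ring_def)
    then show "H = carrier ?M"
      using subset by (auto simp: module_in_ring_def)
  qed
  then have "{\<one>} \<in> {G. finite G \<and> G \<subseteq> carrier ?M \<and> ?generates G}"
    using subringE(3)[OF S] by (simp add: module_in_ring_def)
  then show "(INF G\<in>{G. finite G \<and> G \<subseteq> carrier ?M \<and> ?generates G}. enat (card G)) \<le> 1"
    by (rule INF_lower2) (simp add: one_enat_def)
  show "1 \<le> (INF G\<in>{G. finite G \<and> G \<subseteq> carrier ?M \<and> ?generates G}. enat (card G))"
  proof (rule INF_greatest)
    fix G assume "G \<in> {G. finite G \<and> G \<subseteq> carrier ?M \<and> ?generates G}"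
    then have "finite G" and gen: "?generates G"
      by auto
    \<comment> \<open>Closure of the zero submodule under inverses refers to \<open>m_inv\<close> in
      the additive monoid of the module, which is evaluated directly from its definite
      description.\<close>
    have "inv\<^bsub>add_monoid ?M\<^esub> \<zero> = \<zero>"
      unfolding m_inv_def using subringE(1,2)[OF S]
      by (intro the_equality) (auto simp: module_in_ring_def)
    then have "subgroup {\<zero>} (add_monoid ?M)"
      using subringE(2)[OF S] by (auto simp: subgroup_def module_in_ring_def)
    moreover have "submodule_axioms {\<zero>} (R\<lparr>carrier := S\<rparr>) ?M"
      using subringE(1)[OF S] by (auto simp: submodule_axioms_def module_in_ring_def)
    ultimately have zero: "submodule {\<zero>} (R\<lparr>carrier := S\<rparr>) ?M"
      by (simp add: submodule_def)
    \<comment> \<open>An empty generating set is contained in the zero submodule.\<close>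
    have "G \<noteq> {}"
    proof
      assume "G = {}"
      then have "{\<zero>} = carrier ?M"
        using gen zero by blast
      then show False
        using subringE(3)[OF S] \<open>\<one> \<noteq> \<zero>\<close> by (auto simp: module_in_ring_def)
    qed
    then show "1 \<le> enat (card G)"
      using \<open>finite G\<close> by (simp add: one_enat_def Suc_le_eq card_gt_0_iff)
  qed
qed

section \<open>Characters of abelian representations\<close>

text \<open>The trivial representation is a witness. Nonemptiness separates 1 from 0 in the ring of
  functions.\<close>

lemma abelian_characters_nonempty: "abelian_characters N x0 \<noteq> {}"
proof -
  have "\<one>\<^bsub>SL2C\<^esub> \<in> carrier SL2C" "\<one>\<^bsub>SL2C\<^esub> \<otimes>\<^bsub>SL2C\<^esub> \<one>\<^bsub>SL2C\<^esub> = \<one>\<^bsub>SL2C\<^esub>"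
    by (simp_all add: SL2C_def)
  \<comment> \<open>The source \<open>G\<close> is arbitrary, so that one fact covers both the
    fundamental group and the homology group.\<close>
  then have "(\<lambda>_. \<one>\<^bsub>SL2C\<^esub>) \<in> hom G SL2C" for G :: "('b, 'c) monoid_scheme"
    by (simp add: hom_def)
  then have "(\<lambda>_. \<one>\<^bsub>SL2C\<^esub>) \<in> hom (fundamental_group N x0) SL2C"
    "(\<lambda>_. \<one>\<^bsub>SL2C\<^esub>) \<in> hom (homology_group 1 N) SL2C"
    by blast+
  then have "(\<lambda>_. \<one>\<^bsub>SL2C\<^esub>) \<in> abelian_representations N x0"
    unfolding abelian_representations_def by fast
  then show ?thesis
    unfolding abelian_characters_def by blast
qed

text \<open>The algebraic core: once \<open>s\<close> generates all trace functions over the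
  integers, each scalar ring equals the ring on which it acts, and a nonzero ring has rank 1 over
  itself.\<close>

lemma rank_eq_1:
  assumes "X \<noteq> {}"
    and s: "s \<in> trace_function X ` carrier (fundamental_group N x0)"
    and traces: "trace_function X ` carrier (fundamental_group N x0) \<subseteq> generate_ring (function_ring X) {s}"
    and \<alpha>: "slope_trace_function N x0 X \<alpha> = s"
  shows "rank_C N x0 X \<alpha> = 1" "rank_Z N x0 X \<alpha> = 1"
proof -
  interpret F: ring "function_ring X"
    by (rule ring_function_ring)
  define T where "T = trace_function X ` carrier (fundamental_group N x0)"
  define C where "C = constant_functions X"
  define R where "R = coordinate_ring N x0 X"
  have CT: "C \<union> T \<subseteq> carrier (function_ring X)"
    by (auto simp: C_def T_def constant_functions_def trace_function_def function_ring_def)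
  have R_eq: "R = (function_ring X)\<lparr>carrier := generate_ring (function_ring X) (C \<union> T)\<rparr>"
    unfolding R_def C_def T_def coordinate_ring_def ..
  have sub: "subring (generate_ring (function_ring X) (C \<union> T)) (function_ring X)"
    using CT by (rule F.generate_ring_is_subring)
  interpret ring R
    unfolding R_eq using sub by (rule F.subring_is_ring)
  have gen: "generate_ring R K = generate_ring (function_ring X) K" if "K \<subseteq> C \<union> T" for K
    unfolding R_eq
  proof (rule F.generate_ring_subring[OF sub])
    show "K \<subseteq> generate_ring (function_ring X) (C \<union> T)"
      using that generate_ring.incl[of _ "C \<union> T"] by blast
  qed
  have sT: "s \<in> T" "T \<subseteq> generate_ring (function_ring X) {s}"
    using s traces by (simp_all add: T_def)
  have "generate_ring R (C \<union> {s}) = generate_ring (function_ring X) (C \<union> {s})"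
    using sT by (intro gen) auto
  also have "\<dots> = generate_ring (function_ring X) (C \<union> T)"
  proof (rule F.generate_ring_eqI)
    have "generate_ring (function_ring X) {s} \<subseteq> generate_ring (function_ring X) (C \<union> {s})"
      using CT sT by (intro F.mono_generate_ring) auto
    then show "C \<union> T \<subseteq> generate_ring (function_ring X) (C \<union> {s})"
      using sT(2) generate_ring.incl[of _ "C \<union> {s}"] by blast
  qed (use CT sT in auto)
  finally have C_eq: "generate_ring R (C \<union> {s}) = carrier R"
    by (simp add: R_eq)
  have "generate_ring (function_ring X) {s} = generate_ring (function_ring X) T"
    using CT sT by (intro F.generate_ring_eqI) auto
  then have T_eq: "generate_ring R {s} = generate_ring R T"
    using sT gen by simp
  \<comment> \<open>At a point of \<open>X\<close> the constant functions 1 and 0 differ.\<close>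
  have "\<one>\<^bsub>R\<^esub> \<noteq> \<zero>\<^bsub>R\<^esub>"
    using \<open>X \<noteq> {}\<close> by (auto simp: R_eq function_ring_def fun_eq_iff)
  note rank = module_rank_self[OF _ this]
  have "T \<subseteq> carrier R"
    using generate_ring.incl[of _ "C \<union> T" "function_ring X"] by (auto simp: R_eq)
  then have "subring (generate_ring R T) R"
    by (rule generate_ring_is_subring)
  then show "rank_Z N x0 X \<alpha> = 1"
    unfolding rank_Z_def Let_def R_def[symmetric] \<alpha> trace_ring_def T_def[symmetric] T_eq by (rule rank)
  show "rank_C N x0 X \<alpha> = 1"
    unfolding rank_C_def Let_def R_def[symmetric] \<alpha> C_def[symmetric] C_eq
    using carrier_is_subring by (rule rank)
qed

text \<open>The representation factors through homology, so its value at \<delta> is the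
  \<open>k\<close>-th power of its value at \<gamma>, and the trace of that power is a polynomial in
  the trace.\<close>

lemma abelian_character_power:
  assumes "x \<in> abelian_characters N x0"
    and "\<gamma> \<in> carrier (fundamental_group N x0)" "\<delta> \<in> carrier (fundamental_group N x0)"
    and "hurewicz N \<delta> = hurewicz N \<gamma> [^]\<^bsub>homology_group 1 N\<^esub> (k::int)"
  shows "x \<delta> = trace_poly (nat \<bar>k\<bar>) (x \<gamma>)"
proof -
  obtain \<rho> \<phi> where x: "x = character_of N x0 \<rho>" and \<phi>: "\<phi> \<in> hom (homology_group 1 N) SL2C"
    and \<rho>: "\<And>g. g \<in> carrier (fundamental_group N x0) \<Longrightarrow> \<rho> g = \<phi> (hurewicz N g)"
    using assms(1) unfolding abelian_characters_def abelian_representations_def by blast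
  have x_eq: "x g = trace (\<phi> (hurewicz N g))" if "g \<in> carrier (fundamental_group N x0)" for g
    using that by (simp add: x character_of_def \<rho>)
  have h: "hurewicz N \<gamma> \<in> carrier (homology_group 1 N)"
    using assms(2) by (rule hurewicz_in_homology_group)
  then have "\<phi> (hurewicz N \<delta>) = \<phi> (hurewicz N \<gamma>) [^]\<^bsub>SL2C\<^esub> k"
    unfolding assms(4) using \<phi> group_SL2C by (simp add: hom_int_pow)
  then show ?thesis
    using assms(2,3) h \<phi> by (simp add: x_eq trace_int_pow_SL2C hom_in_carrier)
qed

theorem proposition1p3:
  fixes N :: "'a topology" and x0 :: 'a and \<gamma> \<alpha> :: "(real \<Rightarrow> 'a) set"
  assumes "knot_manifold N"
    and "x0 \<in> topspace N"
    and "homology_group 1 N \<cong> integer_group"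
    and "\<gamma> \<in> peripheral_elements N x0"
    and "generate (homology_group 1 N) {hurewicz N \<gamma>} = carrier (homology_group 1 N)"
    and "\<alpha> \<in> slopes N"
    and "represents_slope N x0 \<gamma> \<alpha>"
  shows "rank_C N x0 (abelian_characters N x0) \<alpha> = 1
       \<and> rank_Z N x0 (abelian_characters N x0) \<alpha> = 1"
proof -
  interpret H: group "homology_group 1 N"
    by simp
  define X where "X = abelian_characters N x0"
  define s where "s = trace_function X \<gamma>"
  have \<gamma>: "\<gamma> \<in> carrier (fundamental_group N x0)"
    using represents_slope_in_fundamental_group[OF assms(6,7)] .
  note h = hurewicz_in_homology_group[OF \<gamma>]
  have "trace_function X g \<in> generate_ring (function_ring X) {s}"
    if g: "g \<in> carrier (fundamental_group N x0)" for g
  proof -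
    have "hurewicz N g \<in> generate (homology_group 1 N) {hurewicz N \<gamma>}"
      using assms(5) hurewicz_in_homology_group[OF g] by simp
    \<comment> \<open>A subgroup generated by one element consists of its integer powers.\<close>
    then obtain k :: int where "hurewicz N g = hurewicz N \<gamma> [^]\<^bsub>homology_group 1 N\<^esub> k"
      using H.generate_pow[OF h] by blast
    then have "trace_function X g = (\<lambda>x\<in>X. trace_poly (nat \<bar>k\<bar>) (s x))"
      unfolding trace_function_def s_def X_def
      by (intro restrict_ext) (simp add: abelian_character_power[OF _ \<gamma> g])
    moreover have "s \<in> carrier (function_ring X)"
      by (simp add: s_def trace_function_def function_ring_def)
    ultimately show ?thesis
      using trace_poly_in_generate_ring by metis
  qed
  moreover have "slope_trace_function N x0 X \<alpha> = s"
  proof -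
    \<comment> \<open>\<delta> is the representative chosen by \<open>slope_trace_function\<close>;
      it may differ from \<gamma>.\<close>
    define \<delta> where "\<delta> = (SOME \<delta>. represents_slope N x0 \<delta> \<alpha>)"
    have rep: "represents_slope N x0 \<delta> \<alpha>"
      unfolding \<delta>_def using assms(7) by (rule someI[where P = "\<lambda>\<delta>. represents_slope N x0 \<delta> \<alpha>"])
    have \<delta>: "\<delta> \<in> carrier (fundamental_group N x0)"
      using represents_slope_in_fundamental_group[OF assms(6) rep] by simp
    have "hurewicz N \<delta> = hurewicz N \<gamma> [^]\<^bsub>homology_group 1 N\<^esub> (1::int) \<or>
        hurewicz N \<delta> = hurewicz N \<gamma> [^]\<^bsub>homology_group 1 N\<^esub> (-1::int)"
      using represents_slope_unique_up_to_inverse[OF assms(6,7) rep] h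
      by (simp add: H.int_pow_neg)
    \<comment> \<open>Both exponents have absolute value 1, and \<open>trace_poly\<close> at 1 is
      the identity.\<close>
    then have "x \<delta> = x \<gamma>" if "x \<in> X" for x
      using abelian_character_power[OF that[unfolded X_def] \<gamma> \<delta>] by fastforce
    then show ?thesis
      unfolding slope_trace_function_def \<delta>_def[symmetric] s_def trace_function_def
      by (intro restrict_ext)
  qed
  moreover have "X \<noteq> {}"
    unfolding X_def by (rule abelian_characters_nonempty)
  ultimately show ?thesis
    using rank_eq_1[of X s N x0 \<alpha>] \<gamma> by (auto simp: s_def X_def)
qed

end
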